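(* Let $A$ be a commutative unital Banach algebra over $\mathbb K$, where $\mathbb K=\mathbb R$ or $\mathbb K=\mathbb C$. Then, for $g\in A$, the set $$R_n^{\exp}(g):=\{\mathbf f\in A^n:\ (\mathbf f,g)\text{ is reducible to the principal component of }U_n(A)\}=g\,A^n+\mathcal P(U_n(A))$$ is open-closed inside $I_n(g)$. In particular, if $\mathbf F:[0,1]\to I_n(g)$ is a continuous map for which $(\mathbf F(0),g)$ is reducible to the principal component of $U_n(A)$, then $(\mathbf F(1),g)$ is reducible to the principal component of $U_n(A)$, too.
   Context: $\mathbf 1$ is the identity of $A$. $U_n(A)$ is the set of tuples $(f_1,\dots,f_n)\in A^n$ for which there is $(x_1,\dots,x_n)\in A^n$ with $\sum_{j=1}^n x_jf_j=\mathbf 1$ (invertible tuples), with the topology induced by $A^n$. $I_n(g):=\{\mathbf f\in A^n:(\mathbf f,g)\in U_{n+1}(A)\}$, an open subset of $A^n$. $\mathcal M_n(A)$ is the set of $n\times n$ matrices over $A$, and $\mathrm{Exp}\,\mathcal M_n(A)=\{e^{M_1}\cdots e^{M_k}:k\in\mathbb N,\ M_j\in\mathcal M_n(A)\}$. With $\mathbf e_1=(\mathbf 1,0,\dots,0)\in A^n$, the principal component of $U_n(A)$ is the connected component of $\mathbf e_1$ in $U_n(A)$, given by $\mathcal P(U_n(A))=\mathbf e_1\cdot\mathrm{Exp}\,\mathcal M_n(A)$. A tuple $(\mathbf f,g)\in U_{n+1}(A)$ with $\mathbf f\in A^n$ is reducible to the principal component of $U_n(A)$ if there is $\mathbf h\in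 A^n$ with $\mathbf f+g\,\mathbf h\in\mathcal P(U_n(A))$. *)

theory Defs
  imports "HOL-Analysis.Analysis"
begin

text \<open>
  A commutative unital Banach algebra is a type of sort
  \<open>{comm_ring_1, real_normed_algebra, banach}\<close>; the normalisation \<open>norm 1 = 1\<close> is not required.
  Restricting scalars turns a complex Banach algebra into a real one with the same ring
  operations and the same norm. Nothing below mentions scalars, so this sort
  covers both \<open>\<real>\<close> and \<open>\<complex>\<close> as ground field.

  \<open>A\<^sup>n\<close> is \<^typ>\<open>'a ^ 'n\<close> with its product topology, where \<open>n = CARD('n)\<close>, so \<open>n \<ge> 1\<close>. The index
  type is linearly ordered where the first coordinate matters; a finite linear order is,
  in exactly one way, a copy of \<open>{1..n}\<close>.
\<close>

definition inv_tuples :: "('a::comm_ring_1 ^ 'n) set"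
  where "inv_tuples = {f. \<exists>x. (\<Sum>j\<in>UNIV. x $ j * f $ j) = 1}"

text \<open>The \<open>(n+1)\<close>-tuple \<open>(f, g)\<close>, indexed by \<^typ>\<open>'n option\<close>; \<^const>\<open>None\<close> is the last position.\<close>

definition tuple_snoc :: "'a ^ 'n \<Rightarrow> 'a \<Rightarrow> 'a ^ ('n option)"
  where "tuple_snoc f g = (\<chi> j. case j of Some i \<Rightarrow> f $ i | None \<Rightarrow> g)"

definition inv_completions :: "'a::comm_ring_1 \<Rightarrow> ('a ^ 'n) set"
  where "inv_completions g = {f. tuple_snoc f g \<in> inv_tuples}"

definition first_unit :: "'a::comm_ring_1 ^ 'n::{finite,linorder}"
  where "first_unit = axis (Min UNIV) 1"

definition principal_component ::
    "('a::{comm_ring_1,real_normed_algebra,banach} ^ 'n::{finite,linorder}) set"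
  where "principal_component = connected_component_set inv_tuples first_unit"

definition reducible_to_principal ::
    "'a::{comm_ring_1,real_normed_algebra,banach} ^ 'n::{finite,linorder} \<Rightarrow> 'a \<Rightarrow> bool"
  where "reducible_to_principal f g \<longleftrightarrow>
    tuple_snoc f g \<in> inv_tuples \<and> (\<exists>h. f + g *s h \<in> principal_component)"

definition R_exp ::
    "'a::{comm_ring_1,real_normed_algebra,banach} \<Rightarrow> ('a ^ 'n::{finite,linorder}) set"
  where "R_exp g = {f. reducible_to_principal f g}"

end

theory Submission
  imports Defs
begin

text \<open>
  Openness: \<open>R_exp g\<close> is a union of translates of the principal component, which is open
  because \<open>inv_tuples\<close> is open in a locally connected space.

  Closedness: let \<open>x\<close>, \<open>y\<close> solve \<open>x \<bullet> f + y g = 1\<close>, let \<open>f' + g h'\<close> be a point \<open>p\<close> of the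
  principal component, and put \<open>d = f - f'\<close> and \<open>c = x \<bullet> d\<close>. If \<open>norm c < 1\<close>, then
  \<open>s = 1 / (1 - c)\<close> exists, and \<open>q = p + s (p \<bullet> x) d\<close> is of the form \<open>f + g h\<close>. The segment from \<open>p\<close>
  to \<open>q\<close> consists of the images of \<open>p\<close> under the matrices \<open>I + t s x\<^sup>T d\<close>. These are invertible
  because they are rank-one perturbations of \<open>I\<close> with determinant \<open>1 + t s c\<close>, a unit. So the segment
  stays in \<open>inv_tuples\<close>, and \<open>q\<close> is in the principal component as well.
\<close>

text \<open>The inverse is the fixed point of the contraction \<open>\<lambda>s. 1 + c * s\<close>,
  so Banach's fixed point theorem replaces the Neumann series.\<close>

lemma ex_inverse_one_minus:
  fixes c :: "'a::{comm_ring_1,real_normed_algebra,banach}"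
  assumes "norm c < 1"
  shows "\<exists>s. s * (1 - c) = 1"
proof -
  have "dist (1 + c * x) (1 + c * y) \<le> norm c * dist x y" for x y
    using norm_mult_ineq[of c "x - y"] by (simp add: dist_norm algebra_simps)
  then have "\<exists>!s. 1 + c * s = s"
    using assms by (intro banach_fix_type[where c = "norm c"]) auto
  then obtain s where "1 + c * s = s"
    by auto
  then have "s * (1 - c) = 1"
    by (simp add: algebra_simps)
  then show ?thesis ..
qed

lemma inv_tuplesI:
  "(\<Sum>j\<in>UNIV. x $ j * f $ j) = 1 \<Longrightarrow> f \<in> inv_tuples"
  by (auto simp: inv_tuples_def)

lemma tuple_snoc_in_inv_tuples_iff:
  fixes f :: "'a::comm_ring_1 ^ 'n::finite"
  shows "tuple_snoc f g \<in> inv_tuples \<longleftrightarrow> (\<exists>x y. (\<Sum>j\<in>UNIV. x $ j * f $ j) + y * g = 1)"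
proof -
  have *: "(\<Sum>j\<in>UNIV. z $ j * tuple_snoc f g $ j)
      = (\<Sum>j\<in>UNIV. z $ Some j * f $ j) + z $ None * g" for z :: "'a ^ 'n option"
    by (simp add: UNIV_option_conv sum.reindex tuple_snoc_def add.commute)
  show ?thesis
  proof
    assume "tuple_snoc f g \<in> inv_tuples"
    then obtain z where "(\<Sum>j\<in>UNIV. z $ j * tuple_snoc f g $ j) = 1"
      by (auto simp: inv_tuples_def)
    then have "(\<Sum>j\<in>UNIV. (\<chi> i. z $ Some i) $ j * f $ j) + z $ None * g = 1"
      by (simp add: *)
    then show "\<exists>x y. (\<Sum>j\<in>UNIV. x $ j * f $ j) + y * g = 1"
      by blast
  next
    assume "\<exists>x y. (\<Sum>j\<in>UNIV. x $ j * f $ j) + y * g = 1"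
    then obtain x y where "(\<Sum>j\<in>UNIV. x $ j * f $ j) + y * g = 1"
      by blast
    then have "(\<Sum>j\<in>UNIV. tuple_snoc x y $ j * tuple_snoc f g $ j) = 1"
      unfolding * by (simp add: tuple_snoc_def)
    then show "tuple_snoc f g \<in> inv_tuples"
      by (rule inv_tuplesI)
  qed
qed

text \<open>If \<open>u\<close> solves the Bezout equation for \<open>p\<close>, then for
  \<open>q\<close> near \<open>p\<close> the same combination is near 1, hence a unit; dividing
  \<open>u\<close> by it solves the equation for \<open>q\<close>.\<close>

lemma open_inv_tuples:
  "open (inv_tuples :: ('a::{comm_ring_1,real_normed_algebra,banach} ^ 'n::finite) set)"
proof (subst open_subopen, intro ballI)
  fix p :: "'a ^ 'n"
  assume "p \<in> inv_tuples"
  then obtain u where u: "(\<Sum>j\<in>UNIV. u $ j * p $ j) = 1"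
    by (auto simp: inv_tuples_def)
  let ?T = "{q. norm (1 - (\<Sum>j\<in>UNIV. u $ j * q $ j)) < 1}"
  have "open ?T"
    by (intro open_Collect_less continuous_intros)
  moreover have "p \<in> ?T"
    by (simp add: u)
  moreover have "?T \<subseteq> inv_tuples"
  proof
    fix q assume "q \<in> ?T"
    then obtain s where "s * (\<Sum>j\<in>UNIV. u $ j * q $ j) = 1"
      using ex_inverse_one_minus[of "1 - (\<Sum>j\<in>UNIV. u $ j * q $ j)"] by auto
    then have "(\<Sum>j\<in>UNIV. (s *s u) $ j * q $ j) = 1"
      by (simp add: sum_distrib_left mult.assoc)
    then show "q \<in> inv_tuples"
      by (rule inv_tuplesI)
  qed
  ultimately show "\<exists>T. open T \<and> p \<in> T \<and> T \<subseteq> inv_tuples"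
    by blast
qed

lemma open_principal_component:
  "open (principal_component ::
    ('a::{comm_ring_1,real_normed_algebra,banach} ^ 'n::{finite,linorder}) set)"
  unfolding principal_component_def
  by (rule open_connected_component) (rule open_inv_tuples)

lemma principal_component_subset: "principal_component \<subseteq> inv_tuples"
  unfolding principal_component_def by (rule connected_component_subset)

text \<open>The new tuple is the row \<open>p\<close> times M = I + \<tau> x^T d. By the
  Sherman-Morrison formula M has the inverse I - \<tau> r x^T d, which carries a solution for
  \<open>p\<close> to one for the new tuple.\<close>

lemma inv_tuples_rank_one_perturbation:
  fixes p x d :: "'a::comm_ring_1 ^ 'n::finite"
  assumes p: "p \<in> inv_tuples" and r: "r * (1 + \<tau> * (\<Sum>j\<in>UNIV. x $ j * d $ j)) = 1"
  shows "p + (\<tau> * (\<Sum>j\<in>UNIV. x $ j * p $ j)) *s d \<in> inv_tuples"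
proof -
  obtain u where u: "(\<Sum>j\<in>UNIV. u $ j * p $ j) = 1"
    using p by (auto simp: inv_tuples_def)
  let ?c = "\<Sum>j\<in>UNIV. x $ j * d $ j" and ?a = "\<Sum>j\<in>UNIV. x $ j * p $ j"
    and ?b = "\<Sum>j\<in>UNIV. u $ j * d $ j"
  define q where "q = p + (\<tau> * ?a) *s d"
  have lin: "(\<Sum>j\<in>UNIV. w $ j * q $ j)
      = (\<Sum>j\<in>UNIV. w $ j * p $ j) + \<tau> * ?a * (\<Sum>j\<in>UNIV. w $ j * d $ j)" for w
    unfolding q_def by (simp add: distrib_left sum.distrib sum_distrib_left[of "\<tau> * ?a"] mult.left_commute)
  \<comment> \<open>The coefficient vector is the inverse matrix applied to the column
    \<open>u\<close>.\<close>
  have "(\<Sum>j\<in>UNIV. (u - (\<tau> * r * ?b) *s x) $ j * q $ j)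
      = (\<Sum>j\<in>UNIV. u $ j * q $ j) - \<tau> * r * ?b * (\<Sum>j\<in>UNIV. x $ j * q $ j)"
    by (simp only: vector_minus_component vector_smult_component left_diff_distrib sum_subtractf
        sum_distrib_left[of "\<tau> * r * ?b"] mult.assoc[of "\<tau> * r * ?b"])
  also have "\<dots> = 1 + \<tau> * ?a * ?b - \<tau> * ?b * ?a * (r * (1 + \<tau> * ?c))"
    unfolding lin u by (simp add: algebra_simps)
  also have "\<dots> = 1"
    unfolding r by (simp add: algebra_simps)
  finally show ?thesis
    unfolding q_def by (rule inv_tuplesI)
qed

lemma principal_component_rank_one_perturbation:
  fixes p x d :: "'a::{comm_ring_1,real_normed_algebra,banach} ^ 'n::{finite,linorder}"
  assumes p: "p \<in> principal_component"
    and c: "norm (\<Sum>j\<in>UNIV. x $ j * d $ j) < 1"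
    and s: "s * (1 - (\<Sum>j\<in>UNIV. x $ j * d $ j)) = 1"
  shows "p + (s * (\<Sum>j\<in>UNIV. x $ j * p $ j)) *s d \<in> principal_component"
proof -
  let ?c = "\<Sum>j\<in>UNIV. x $ j * d $ j" and ?a = "\<Sum>j\<in>UNIV. x $ j * p $ j"
  let ?q = "p + (s * ?a) *s d"
  have "closed_segment p ?q \<subseteq> inv_tuples"
  proof
    fix v assume "v \<in> closed_segment p ?q"
    then obtain t where t: "0 \<le> t" "t \<le> 1" and v: "v = (1 - t) *\<^sub>R p + t *\<^sub>R ?q"
      by (auto simp: in_segment)
    have v': "v = p + ((t *\<^sub>R s) * ?a) *s d"
      unfolding v by (simp add: vec_eq_iff algebra_simps)
    \<comment> \<open>Since \<open>s\<close> inverts \<open>1 - ?c\<close>, the product of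
      \<open>1 - ?c\<close> and \<open>1 + (t *\<^sub>R s) * ?c\<close> is
      \<open>1 - (1 - t) *\<^sub>R ?c\<close>. This is a unit by the norm bound, so
      \<open>r * (1 - ?c)\<close> inverts the second factor.\<close>
    have "norm ((1 - t) *\<^sub>R ?c) \<le> norm ?c"
      using t by (simp add: mult_left_le_one_le)
    then obtain r where r: "r * (1 - (1 - t) *\<^sub>R ?c) = 1"
      using ex_inverse_one_minus c by (meson le_less_trans)
    have "r * (1 - ?c) * (1 + (t *\<^sub>R s) * ?c) = r * ((1 - ?c) + t *\<^sub>R (s * (1 - ?c) * ?c))"
      by (simp add: algebra_simps)
    also have "\<dots> = r * (1 - (1 - t) *\<^sub>R ?c)"
      unfolding s by (simp add: algebra_simps)
    finally have "r * (1 - ?c) * (1 + (t *\<^sub>R s) * ?c) = 1"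
      using r by simp
    then show "v \<in> inv_tuples"
      unfolding v' using p principal_component_subset
      by (intro inv_tuples_rank_one_perturbation) auto
  qed
  then have "connected_component inv_tuples p ?q"
    by (meson connected_component_def connected_segment ends_in_segment)
  then show ?thesis
    using p unfolding principal_component_def by (auto intro: connected_component_trans)
qed

lemma R_exp_eq:
  fixes g :: "'a::{comm_ring_1,real_normed_algebra,banach}"
  shows "(R_exp g :: ('a ^ 'n::{finite,linorder}) set)
    = {g *s h + p | h p. p \<in> principal_component}"
proof (intro set_eqI iffI)
  fix f :: "('a, 'n) vec"
  assume "f \<in> R_exp g"
  then obtain h where "f + g *s h \<in> principal_component"
    by (auto simp: R_exp_def reducible_to_principal_def)
  moreover have "f = g *s (- h) + (f + g *s h)"
    by (simp add: vec_eq_iff)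
  ultimately show "f \<in> {g *s h + p | h p. p \<in> principal_component}"
    by blast
next
  fix f :: "('a, 'n) vec"
  assume "f \<in> {g *s h + p | h p. p \<in> principal_component}"
  then obtain h p where f: "f = g *s h + p" and p: "p \<in> principal_component"
    by blast
  obtain u where u: "(\<Sum>j\<in>UNIV. u $ j * p $ j) = 1"
    using p principal_component_subset by (auto simp: inv_tuples_def)
  \<comment> \<open>Reducibility includes invertibility of \<open>(f, g)\<close>: the last
    coefficient is chosen to cancel the contribution of \<open>g *s h\<close>.\<close>
  have "(\<Sum>j\<in>UNIV. u $ j * f $ j) + (- (\<Sum>j\<in>UNIV. u $ j * h $ j)) * g
      = (\<Sum>j\<in>UNIV. u $ j * p $ j)"
    by (simp add: f algebra_simps sum.distrib sum_distrib_left)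
  then have "tuple_snoc f g \<in> inv_tuples"
    unfolding tuple_snoc_in_inv_tuples_iff using u by metis
  moreover have "f + g *s (- h) = p"
    by (simp add: f vec_eq_iff)
  ultimately show "f \<in> R_exp g"
    using p unfolding R_exp_def reducible_to_principal_def by fastforce
qed

lemma R_exp_subset: "R_exp g \<subseteq> inv_completions g"
  by (auto simp: R_exp_def reducible_to_principal_def inv_completions_def)

lemma open_R_exp:
  fixes g :: "'a::{comm_ring_1,real_normed_algebra,banach}"
  shows "open (R_exp g :: ('a ^ 'n::{finite,linorder}) set)"
proof -
  have "(R_exp g :: ('a, 'n) vec set) = (\<Union>h. (+) (g *s h) ` principal_component)"
    unfolding R_exp_eq by blast
  then show ?thesis
    by (simp add: open_UN open_translation open_principal_component)
qed

text \<open>The bound on \<open>f - f'\<close> involves only \<open>x\<close>, which belongs to the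
  limit point \<open>f\<close>; it is therefore uniform in the approximating points
  \<open>f'\<close>.\<close>

lemma R_exp_near:
  fixes g :: "'a::{comm_ring_1,real_normed_algebra,banach}"
    and f f' :: "'a ^ 'n::{finite,linorder}"
  assumes xy: "(\<Sum>j\<in>UNIV. x $ j * f $ j) + y * g = 1"
    and f': "f' \<in> R_exp g"
    and near: "norm (\<Sum>j\<in>UNIV. x $ j * (f - f') $ j) < 1"
  shows "f \<in> R_exp g"
proof -
  obtain h where p: "f' + g *s h \<in> principal_component"
    using f' by (auto simp: R_exp_def reducible_to_principal_def)
  define p where "p = f' + g *s h"
  define d where "d = f - f'"
  let ?c = "\<Sum>j\<in>UNIV. x $ j * d $ j" and ?b = "\<Sum>j\<in>UNIV. x $ j * h $ j"
  obtain s where s: "s * (1 - ?c) = 1"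
    using ex_inverse_one_minus near unfolding d_def by blast
  \<comment> \<open>Modulo \<open>g\<close> this sum is \<open>1 - ?c\<close>, so multiplying by
    \<open>s\<close> makes it 1. Modulo \<open>g\<close>, the perturbation thus adds exactly
    \<open>d\<close> to \<open>p\<close> and lands on \<open>f\<close>.\<close>
  have "(\<Sum>j\<in>UNIV. x $ j * p $ j) = (\<Sum>j\<in>UNIV. x $ j * f $ j) - ?c + g * ?b"
    by (simp add: p_def d_def algebra_simps sum.distrib sum_subtractf sum_distrib_left)
  also have "\<dots> = (1 - ?c) + g * (?b - y)"
    using xy by (simp add: algebra_simps)
  finally have "s * (\<Sum>j\<in>UNIV. x $ j * p $ j) = s * (1 - ?c) + g * (s * (?b - y))"
    by (simp add: distrib_left mult.left_commute)
  then have a: "s * (\<Sum>j\<in>UNIV. x $ j * p $ j) = 1 + g * (s * (?b - y))"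
    unfolding s .
  have "p + (s * (\<Sum>j\<in>UNIV. x $ j * p $ j)) *s d \<in> principal_component"
    using p near s unfolding p_def d_def by (intro principal_component_rank_one_perturbation)
  moreover have "f = g *s (- h - (s * (?b - y)) *s d)
      + (p + (s * (\<Sum>j\<in>UNIV. x $ j * p $ j)) *s d)"
    unfolding a by (simp add: vec_eq_iff p_def d_def algebra_simps)
  ultimately show ?thesis
    unfolding R_exp_eq by blast
qed

lemma closedin_R_exp:
  fixes g :: "'a::{comm_ring_1,real_normed_algebra,banach}"
  shows "closedin (top_of_set (inv_completions g)) (R_exp g :: ('a ^ 'n::{finite,linorder}) set)"
proof -
  have "f \<in> R_exp g" if f: "f \<in> inv_completions g" "f \<in> closure (R_exp g)" for f :: "('a, 'n) vec"
  proof -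
    obtain x y where xy: "(\<Sum>j\<in>UNIV. x $ j * f $ j) + y * g = 1"
      using f(1) by (auto simp: inv_completions_def tuple_snoc_in_inv_tuples_iff)
    let ?T = "{f'. norm (\<Sum>j\<in>UNIV. x $ j * (f - f') $ j) < 1}"
    have "open ?T"
      by (intro open_Collect_less continuous_intros)
    moreover have "f \<in> ?T"
      by simp
    ultimately obtain f' where "f' \<in> R_exp g" "f' \<in> ?T"
      using f(2) unfolding closure_iff_nhds_not_empty by blast
    then show ?thesis
      using R_exp_near[OF xy] by blast
  qed
  then have "R_exp g = inv_completions g \<inter> closure (R_exp g :: ('a, 'n) vec set)"
    using R_exp_subset closure_subset by blast
  then show ?thesis
    by (metis closedin_closed_Int closed_closure)
qed

theorem theorem4p6:
  fixes g :: "'a::{comm_ring_1,real_normed_algebra,banach}"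
  shows "(R_exp g :: ('a ^ 'n::{finite,linorder}) set)
           = {g *s h + p | h p. p \<in> principal_component} \<and>
         openin (top_of_set (inv_completions g)) (R_exp g :: ('a ^ 'n::{finite,linorder}) set) \<and>
         closedin (top_of_set (inv_completions g)) (R_exp g :: ('a ^ 'n::{finite,linorder}) set) \<and>
         (\<forall>F :: real \<Rightarrow> 'a ^ 'n::{finite,linorder}.
            continuous_on {0..1} F \<and> F ` {0..1} \<subseteq> inv_completions g \<and>
            reducible_to_principal (F 0) g \<longrightarrow> reducible_to_principal (F 1) g)"
proof (intro conjI allI impI)
  show "(R_exp g :: ('a, 'n) vec set) = {g *s h + p | h p. p \<in> principal_component}"
    by (rule R_exp_eq)
  show op: "openin (top_of_set (inv_completions g)) (R_exp g :: ('a, 'n) vec set)"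
    using R_exp_subset by (rule open_subset) (rule open_R_exp)
  show cl: "closedin (top_of_set (inv_completions g)) (R_exp g :: ('a, 'n) vec set)"
    by (rule closedin_R_exp)
  fix F :: "real \<Rightarrow> ('a, 'n) vec"
  assume F: "continuous_on {0..1} F \<and> F ` {0..1} \<subseteq> inv_completions g \<and>
    reducible_to_principal (F 0) g"
  let ?J = "F ` {0..1}"
  have "connected ?J"
    using F by (intro connected_continuous_image) auto
  moreover have "openin (top_of_set ?J) (?J \<inter> R_exp g)"
    by (intro openin_open_Int open_R_exp)
  \<comment> \<open>\<open>R_exp g\<close> is closed only relative to
    \<open>inv_completions g\<close>; as \<open>?J\<close> lies in there, \<open>C\<close> cuts out
    the same part of \<open>?J\<close>.\<close>
  moreover obtain C :: "('a, 'n) vec set" where "closed C" "R_exp g = inv_completions g \<inter> C"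
    using cl unfolding closedin_closed by blast
  then have "closedin (top_of_set ?J) (?J \<inter> R_exp g)"
    using F closedin_closed_Int[of C ?J] by (metis inf.absorb_iff1 inf_assoc)
  moreover have "F 0 \<in> ?J \<inter> R_exp g"
    using F by (auto simp: R_exp_def)
  ultimately have "?J \<inter> R_exp g = ?J"
    unfolding connected_clopen by blast
  then show "reducible_to_principal (F 1) g"
    unfolding R_exp_def by auto
qed

end
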